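(* For every positive integer $m$, $\nu(m)\leq 2^{2^{3m}-1}-1$.
   Context: A matroid on a finite set $S$ is a family $\mathcal{M}$ of subsets of $S$ with $\emptyset\in\mathcal{M}$, closed under subsets, such that for every $A\subseteq S$ all maximal members of $\mathcal{M}$ contained in $A$ have the same cardinality. For a finite simple graph $G=(V,E)$, $M(G)$ is the family of all matchings (sets of pairwise disjoint edges) of $G$, and $\mu(G)$ is the minimum $m\in\mathbb{N}$ such that $M(G)$ is the intersection $\mathcal{M}_1\cap\dots\cap\mathcal{M}_m$ of $m$ matroids on $E$. For $n\in\mathbb{N}$, $\mu(n)=\max\{\mu(G): G \text{ a finite simple graph with } |V|\le n\}$, and for $m\in\mathbb{N}$, $\nu(m)=\sup\{n\in\mathbb{N}:\mu(n)\le m\}$. *)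

theory Defs
  imports Main "HOL-Library.Extended_Nat"
begin

definition maximal_member_in :: "'a set set \<Rightarrow> 'a set \<Rightarrow> 'a set \<Rightarrow> bool" where
  "maximal_member_in M A B \<longleftrightarrow>
     B \<in> M \<and> B \<subseteq> A \<and> (\<forall>B'\<in>M. B' \<subseteq> A \<longrightarrow> B \<subseteq> B' \<longrightarrow> B' = B)"

definition matroid_on :: "'a set \<Rightarrow> 'a set set \<Rightarrow> bool" where
  "matroid_on S M \<longleftrightarrow>
     finite S \<and> M \<subseteq> Pow S \<and> {} \<in> M \<and>
     (\<forall>X\<in>M. \<forall>Y. Y \<subseteq> X \<longrightarrow> Y \<in> M) \<and>
     (\<forall>A. A \<subseteq> S \<longrightarrow>
        (\<forall>B C. maximal_member_in M A B \<longrightarrow> maximal_member_in M A C \<longrightarrow> card B = card C))"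

definition simple_graph :: "'v set \<Rightarrow> 'v set set \<Rightarrow> bool" where
  "simple_graph V E \<longleftrightarrow> finite V \<and> (\<forall>e\<in>E. e \<subseteq> V \<and> card e = 2)"

definition matchings :: "'v set set \<Rightarrow> 'v set set set" where
  "matchings E = {F. F \<subseteq> E \<and> pairwise disjnt F}"

text \<open>Families of subsets of \<open>S\<close> are intersected inside \<open>Pow S\<close>, so that the intersection of zero
  matroids is \<open>Pow S\<close>.\<close>

definition inter_of_matroids :: "'a set \<Rightarrow> nat \<Rightarrow> 'a set set \<Rightarrow> bool" where
  "inter_of_matroids S m I \<longleftrightarrow>
     (\<exists>Ms :: nat \<Rightarrow> 'a set set. (\<forall>i<m. matroid_on S (Ms i)) \<and> I = Pow S \<inter> (\<Inter>i<m. Ms i))"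

definition mu_graph :: "'v set set \<Rightarrow> nat" where
  "mu_graph E = (LEAST m. inter_of_matroids E m (matchings E))"

text \<open>Every finite graph is isomorphic to one whose vertices are natural numbers, so letting \<open>V\<close> range
  over sets of type \<^typ>\<open>nat set\<close> covers all finite simple graphs.\<close>

definition mu_values :: "nat \<Rightarrow> nat set" where
  "mu_values n = {mu_graph E | (V :: nat set) E. simple_graph V E \<and> card V \<le> n}"

definition mu :: "nat \<Rightarrow> nat" where
  "mu n = Max (mu_values n)"

definition nu :: "nat \<Rightarrow> enat" where
  "nu m = (SUP n\<in>{n. mu n \<le> m}. enat n)"


text \<open>The minimum defining \<^const>\<open>mu_graph\<close> and the maximum defining \<^const>\<open>mu\<close> exist: the matchings
  are cut out by one matroid for each pair of distinct intersecting edges.\<close>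

lemma matroid_on_avoid_pair:
  assumes "finite S" "e \<in> S" "f \<in> S"
  shows "matroid_on S {F. F \<subseteq> S \<and> \<not> {e, f} \<subseteq> F}"
proof -
  let ?M = "{F. F \<subseteq> S \<and> \<not> {e, f} \<subseteq> F}"
  have *: "card B = (if {e, f} \<subseteq> A then card A - 1 else card A)"
    if A: "A \<subseteq> S" and B: "maximal_member_in ?M A B" for A B
  proof (cases "{e, f} \<subseteq> A")
    case False
    then have "A \<in> ?M" using A by auto
    then have "A = B" using B unfolding maximal_member_in_def by blast
    then show ?thesis using False by auto
  next
    case True
    have "\<exists>x\<in>{e, f}. x \<notin> B" using B unfolding maximal_member_in_def by auto
    then obtain x where x: "x \<in> {e, f}" "x \<notin> B" by blast
    have "A - {x} \<in> ?M" using A x by auto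
    moreover have "B \<subseteq> A - {x}" using B x unfolding maximal_member_in_def by auto
    ultimately have "A - {x} = B" using B unfolding maximal_member_in_def by blast
    moreover have "x \<in> A" using True x by auto
    ultimately show ?thesis using True by (metis card_Diff_singleton)
  qed
  show ?thesis
    unfolding matroid_on_def
  proof (intro conjI allI impI ballI)
    show "finite S" by fact
    show "?M \<subseteq> Pow S" "{} \<in> ?M" by auto
    show "Y \<in> ?M" if "X \<in> ?M" "Y \<subseteq> X" for X Y using that by blast
    show "card B = card C"
      if "A \<subseteq> S" "maximal_member_in ?M A B" "maximal_member_in ?M A C" for A B C
      using *[OF that(1,2)] *[OF that(1,3)] by simp
  qed
qed

lemma inter_of_matroids_matchings:
  assumes "finite E"
  shows "\<exists>m \<le> card E * card E. inter_of_matroids E m (matchings E)"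
proof -
  define P where "P = {(e, f) \<in> E \<times> E. e \<noteq> f \<and> \<not> disjnt e f}"
  have P_sub: "P \<subseteq> E \<times> E" by (auto simp: P_def)
  then have fin: "finite P" using assms by (meson finite_SigmaI finite_subset)
  have le: "card P \<le> card E * card E"
    using card_mono[OF _ P_sub] assms by (simp add: card_cartesian_product)
  obtain h where h: "bij_betw h {..<card P} P"
    using ex_bij_betw_nat_finite[OF fin]
    by (auto simp: atLeast0LessThan)
  define Ms where "Ms i = {F. F \<subseteq> E \<and> \<not> {fst (h i), snd (h i)} \<subseteq> F}" for i
  have hP: "h ` {..<card P} = P" using h by (simp add: bij_betw_def)
  have "matroid_on E (Ms i)" if "i < card P" for i
  proof -
    have "h i \<in> E \<times> E" using hP P_sub that by blast
    then show ?thesis unfolding Ms_def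
      by (intro matroid_on_avoid_pair assms) (auto simp: mem_Times_iff)
  qed
  moreover have "matchings E = Pow E \<inter> (\<Inter>i<card P. Ms i)"
  proof -
    have "F \<in> matchings E \<longleftrightarrow> F \<subseteq> E \<and> (\<forall>p\<in>P. \<not> {fst p, snd p} \<subseteq> F)" for F
      by (auto simp: matchings_def pairwise_def P_def)
    moreover have "(\<forall>p\<in>P. Q p) \<longleftrightarrow> (\<forall>i<card P. Q (h i))" for Q
      using hP by (metis (no_types, lifting) imageE imageI lessThan_iff)
    ultimately have "F \<in> matchings E \<longleftrightarrow> F \<subseteq> E \<and> (\<forall>i<card P. F \<in> Ms i)" for F
      unfolding Ms_def by auto
    then show ?thesis by auto
  qed
  ultimately show ?thesis using le unfolding inter_of_matroids_def by blast
qed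

lemma simple_graph_edges:
  assumes "simple_graph V E"
  shows "finite E" "card E \<le> 2 ^ card V"
proof -
  have "E \<subseteq> Pow V" "finite (Pow V)" using assms by (auto simp: simple_graph_def)
  then show "finite E" "card E \<le> 2 ^ card V"
    using card_mono[of "Pow V" E] assms
    by (auto simp: simple_graph_def card_Pow intro: finite_subset)
qed

lemma mu_graph_attained:
  assumes "simple_graph V E"
  shows "inter_of_matroids E (mu_graph E) (matchings E)"
  using inter_of_matroids_matchings[OF simple_graph_edges(1)[OF assms]]
  unfolding mu_graph_def by (auto intro: LeastI)

lemma finite_mu_values: "finite (mu_values n)"
proof -
  have "mu_graph E \<le> 2 ^ n * 2 ^ n" if g: "simple_graph V E" "card V \<le> n" for V :: "nat set" and E
  proof -
    obtain m where m: "m \<le> card E * card E" "inter_of_matroids E m (matchings E)"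
      using inter_of_matroids_matchings[OF simple_graph_edges(1)[OF g(1)]] by blast
    have "mu_graph E \<le> m" unfolding mu_graph_def using m(2) by (rule Least_le)
    moreover have "card E \<le> 2 ^ n"
      using simple_graph_edges(2)[OF g(1)] g(2)
      by (meson le_trans one_le_numeral power_increasing)
    ultimately show ?thesis using m(1) by (meson le_trans mult_le_mono)
  qed
  then have "mu_values n \<subseteq> {..2 ^ n * 2 ^ n}" by (auto simp: mu_values_def)
  then show ?thesis by (rule finite_subset) simp
qed

lemma mu_values_nonempty: "mu_values n \<noteq> {}"
proof -
  have "simple_graph ({} :: nat set) {} \<and> card ({} :: nat set) \<le> n"
    by (simp add: simple_graph_def)
  then show ?thesis unfolding mu_values_def by blast
qed

end

theory Submission
  imports Defs
begin

text \<open>For an edge \<open>{x, y}\<close> with \<open>x < y\<close> of the complete graph on \<open>V\<close>, let the colour \<open>c x y\<close> be the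
  set of those \<open>i\<close> for which \<open>{x, y}\<close> is parallel, in the \<open>i\<close>th matroid, to some \<open>{y, z}\<close> with \<open>z > y\<close>.
  If \<open>x < y < z\<close>, then \<open>{x, y}\<close> and \<open>{y, z}\<close> are parallel in some matroid, so some \<open>i\<close> lies in
  \<open>c x y\<close>; it cannot lie in \<open>c y z\<close>, because by transitivity \<open>{x, y}\<close> would be parallel to a disjoint
  edge. So \<open>c\<close> properly colours the shift graph: the colour \<open>c x y\<close> belongs to
  \<open>S x = {c x z | z > x}\<close> but not to \<open>S y\<close>, whence \<open>S\<close> is injective and \<open>card V \<le> 2 ^ 2 ^ k\<close> for
  \<open>k\<close> matroids.\<close>

text \<open>Otherwise \<open>{f}\<close> and \<open>{e, g}\<close> would both be maximal members
  inside \<open>{e, f, g}\<close>, since a member containing \<open>f\<close> contains neither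
  \<open>e\<close> nor \<open>g\<close>; but their cardinalities differ.\<close>

lemma matroid_on_parallel_trans:
  assumes M: "matroid_on S M" and "f \<in> S" and single: "{f} \<in> M"
    and ef: "{e, f} \<notin> M" and fg: "{f, g} \<notin> M" and "e \<noteq> g"
  shows "{e, g} \<notin> M"
proof
  assume eg: "{e, g} \<in> M"
  have sub: "Y \<in> M" if "X \<in> M" "Y \<subseteq> X" for X Y
    using M that unfolding matroid_on_def by metis
  have "M \<subseteq> Pow S" using M unfolding matroid_on_def by (elim conjE)
  then have "{e, g} \<subseteq> S" using eg by blast
  then have A: "{e, f, g} \<subseteq> S" using \<open>f \<in> S\<close> by auto
  have no: "e \<notin> B \<and> g \<notin> B" if "B \<in> M" "f \<in> B" for B
    using sub[OF that(1), of "{e, f}"] sub[OF that(1), of "{f, g}"] ef fg that(2) by auto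
  have "maximal_member_in M {e, f, g} {f}"
    unfolding maximal_member_in_def using single no by auto
  moreover have "maximal_member_in M {e, f, g} {e, g}"
    unfolding maximal_member_in_def using eg no by blast
  ultimately have "card {f} = card {e, g}" using M A unfolding matroid_on_def by metis
  then show False using \<open>e \<noteq> g\<close> by simp
qed

lemma card_le_of_shift_coloring:
  fixes V :: "'v::linorder set"
  assumes "finite C"
    and range: "\<And>x y. \<lbrakk>x \<in> V; y \<in> V; x < y\<rbrakk> \<Longrightarrow> c x y \<in> C"
    and proper: "\<And>x y z. \<lbrakk>x \<in> V; y \<in> V; z \<in> V; x < y; y < z\<rbrakk> \<Longrightarrow> c x y \<noteq> c y z"
  shows "card V \<le> 2 ^ card C"
proof -
  define S where "S x = c x ` {z \<in> V. x < z}" for x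
  have neq: "S x \<noteq> S y" if "x \<in> V" "y \<in> V" "x < y" for x y
  proof -
    have "c x y \<in> S x" using that by (auto simp: S_def)
    moreover have "c x y \<notin> S y" using that proper by (auto simp: S_def)
    ultimately show ?thesis by blast
  qed
  have "inj_on S V" using neq by (metis inj_onI linorder_neqE)
  moreover have "S ` V \<subseteq> Pow C" using range by (auto simp: S_def)
  ultimately have "card V \<le> card (Pow C)" using \<open>finite C\<close> by (intro card_inj_on_le) auto
  then show ?thesis using \<open>finite C\<close> by (simp add: card_Pow)
qed

lemma card_le_of_inter_of_matroids_complete_graph:
  fixes V :: "'v::linorder set"
  defines "E \<equiv> {{x, y} | x y. x \<in> V \<and> y \<in> V \<and> x \<noteq> y}"
  assumes "inter_of_matroids E k (matchings E)"
  shows "card V \<le> 2 ^ 2 ^ k"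
proof -
  obtain Ms where Ms: "\<And>i. i < k \<Longrightarrow> matroid_on E (Ms i)"
    and eq: "matchings E = Pow E \<inter> (\<Inter>i<k. Ms i)"
    using assms(2) unfolding inter_of_matroids_def by blast
  have E: "{x, y} \<in> E" if "x \<in> V" "y \<in> V" "x < y" for x y
    using that unfolding E_def by force
  have matching: "F \<in> Ms i" if "F \<in> matchings E" "i < k" for F i
    using that eq by blast
  define c where
    "c x y = {i. i < k \<and> (\<exists>z\<in>V. y < z \<and> {{x, y}, {y, z}} \<notin> Ms i)}" for x y
  have "c x y \<noteq> c y z" if V: "x \<in> V" "y \<in> V" "z \<in> V" and less: "x < y" "y < z" for x y z
  proof -
    have "{{x, y}, {y, z}} \<notin> matchings E"
      using less by (auto simp: matchings_def pairwise_def disjnt_def doubleton_eq_iff)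
    \<comment> \<open>Both edges lie in \<open>E\<close>, so the pair passes \<open>Pow E\<close>
      and some matroid must exclude it.\<close>
    then obtain i where i: "i < k" "{{x, y}, {y, z}} \<notin> Ms i"
      using eq E V less by auto
    then have "i \<in> c x y" using V less by (auto simp: c_def)
    moreover have "i \<notin> c y z"
    proof
      assume "i \<in> c y z"
      then obtain w where w: "w \<in> V" "z < w" "{{y, z}, {z, w}} \<notin> Ms i" by (auto simp: c_def)
      have "{{y, z}} \<in> Ms i"
        using E V less i(1) by (intro matching) (auto simp: matchings_def)
      moreover have "{x, y} \<noteq> {z, w}" using less w by (auto simp: doubleton_eq_iff)
      ultimately have "{{x, y}, {z, w}} \<notin> Ms i"
        using matroid_on_parallel_trans[OF Ms[OF i(1)] E[OF V(2,3) less(2)]] i(2) w(3) by blast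
      \<comment> \<open>Disjoint because \<open>x < y < z < w\<close>; this is why \<open>c\<close>
        only looks at larger third vertices.\<close>
      moreover have "{{x, y}, {z, w}} \<in> matchings E"
        using E V w less by (auto simp: matchings_def pairwise_def disjnt_def)
      ultimately show False using matching i(1) by blast
    qed
    ultimately show ?thesis by blast
  qed
  then have "card V \<le> 2 ^ card (Pow {..<k})"
    by (intro card_le_of_shift_coloring[where c = c]) (auto simp: c_def)
  then show ?thesis by (simp add: card_Pow)
qed

lemma le_of_mu_le:
  assumes "mu n \<le> m"
  shows "n \<le> 2 ^ 2 ^ m"
proof -
  \<comment> \<open>The complete graph on \<open>n\<close> vertices is among the graphs over which
    \<open>mu n\<close> is the maximum.\<close>
  define E where "E = {{x, y} | x y. x \<in> {..<n} \<and> y \<in> {..<n} \<and> x \<noteq> y}"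
  have graph: "simple_graph {..<n} E"
    by (auto simp: simple_graph_def E_def)
  moreover have "card {..<n} \<le> n" by simp
  ultimately have "mu_graph E \<in> mu_values n"
    unfolding mu_values_def by blast
  then have "mu_graph E \<le> m"
    using Max_ge[OF finite_mu_values] assms unfolding mu_def by (meson le_trans)
  moreover have "n \<le> 2 ^ 2 ^ mu_graph E"
    using card_le_of_inter_of_matroids_complete_graph[of "{..<n}"] mu_graph_attained[OF graph]
    unfolding E_def by simp
  ultimately show ?thesis
    by (meson le_trans one_le_numeral power_increasing)
qed

theorem theorem4:
  fixes m :: nat
  assumes "m > 0"
  shows "nu m \<le> enat (2 ^ (2 ^ (3 * m) - 1) - 1)"
proof -
  \<comment> \<open>It remains to compare \<open>2 ^ 2 ^ m\<close> with the stated bound. Strict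
    inequality of the exponents absorbs the final \<open>- 1\<close>.\<close>
  have "(2::nat) ^ m * 2 \<le> 2 ^ m * 2 ^ (2 * m)"
    using assms by (intro mult_le_mono) (auto simp: self_le_power)
  also have "\<dots> = 2 ^ (3 * m)" by (simp flip: power_add)
  finally have "(2::nat) ^ m * 2 \<le> 2 ^ (3 * m)" .
  moreover have "(2::nat) \<le> 2 ^ m" using assms by (simp add: self_le_power)
  ultimately have "(2::nat) ^ m < 2 ^ (3 * m) - 1" by linarith
  then have "(2::nat) ^ 2 ^ m < 2 ^ (2 ^ (3 * m) - 1)" by simp
  then have bound: "(2::nat) ^ 2 ^ m \<le> 2 ^ (2 ^ (3 * m) - 1) - 1" by linarith
  have "n \<le> 2 ^ (2 ^ (3 * m) - 1) - 1" if "mu n \<le> m" for n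
    using le_of_mu_le[OF that] bound by (rule le_trans)
  then show ?thesis unfolding nu_def by (intro SUP_least) simp
qed

end
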